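(* Let $G=(V,E_G)$ be the $d$-dimensional grid graph with side lengths $(n_1,\dots,n_d)$, let $E,F\in V$ be two distinct non-adjacent vertices, and let $G'=(V,E_G\cup\{EF\})$. Then $\beta(G')\le 2d+2$. Moreover, with $N_\Sigma=\sum_i n_i$ and $N_\Pi=\prod_i n_i$, $$\beta(G')\ge \frac{\log(N_\Pi)}{\log(N_\Sigma-d+1)}.$$
   Context: The $d$-dimensional grid graph with side lengths $(n_1,\dots,n_d)$ has vertices the integer vectors $(x^{(1)},\dots,x^{(d)})$ with $1\le x^{(i)}\le n_i$, two vertices adjacent iff they differ by exactly $1$ in exactly one coordinate. For a connected graph $H$, a set $R$ of vertices is resolving if every pair of distinct vertices $A\ne B$ has some $X\in R$ with $d_H(A,X)\ne d_H(B,X)$ ($d_H$ = shortest-path distance); the metric dimension $\beta(H)$ is the minimum size of a resolving set. *)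

theory Defs
  imports Complex_Main "HOL-Library.FuncSet"
begin

text \<open>
  A finite simple graph is given by its vertex set and its set of edges, each edge being a
  two-element set of vertices.
\<close>

definition adj_rel :: "'a set set \<Rightarrow> ('a \<times> 'a) set" where
  "adj_rel Es = {(x, y). {x, y} \<in> Es}"

text \<open>
  A pair \<open>(x, y)\<close> lies in the \<open>k\<close>-th relational power of the adjacency relation iff there is a
  walk of length \<open>k\<close> from \<open>x\<close> to \<open>y\<close>. The value is meaningful only for vertices that
  are joined by a walk; metric dimension is considered for connected graphs only.
\<close>

definition graph_dist :: "'a set set \<Rightarrow> 'a \<Rightarrow> 'a \<Rightarrow> nat" where
  "graph_dist Es x y = (LEAST k. (x, y) \<in> adj_rel Es ^^ k)"

definition resolving_set :: "'a set \<Rightarrow> 'a set set \<Rightarrow> 'a set \<Rightarrow> bool" where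
  "resolving_set V Es R \<longleftrightarrow> R \<subseteq> V \<and>
     (\<forall>a\<in>V. \<forall>b\<in>V. a \<noteq> b \<longrightarrow> (\<exists>x\<in>R. graph_dist Es a x \<noteq> graph_dist Es b x))"

definition metric_dimension :: "'a set \<Rightarrow> 'a set set \<Rightarrow> nat" where
  "metric_dimension V Es = (LEAST k. \<exists>R. finite R \<and> resolving_set V Es R \<and> card R = k)"

text \<open>
  Vectors with \<open>d\<close> integer coordinates are extensional functions on \<open>{1..d}\<close>, so that equality of
  vectors is equality of functions.
\<close>

definition grid_verts :: "nat \<Rightarrow> (nat \<Rightarrow> nat) \<Rightarrow> (nat \<Rightarrow> int) set" where
  "grid_verts d n = (\<Pi>\<^sub>E i\<in>{1..d}. {1..int (n i)})"

definition grid_edges :: "nat \<Rightarrow> (nat \<Rightarrow> nat) \<Rightarrow> (nat \<Rightarrow> int) set set" where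
  "grid_edges d n = {{x, y} | x y. x \<in> grid_verts d n \<and> y \<in> grid_verts d n \<and>
     (\<exists>i\<in>{1..d}. \<bar>x i - y i\<bar> = 1 \<and> (\<forall>j\<in>{1..d} - {i}. x j = y j))}"

end

theory Submission
  imports Defs
begin

text \<open>
  Distances in \<open>G'\<close> differ from the \<open>\<ell>\<^sub>1\<close>-distance only for pairs whose ends lie strictly on
  different sides of the bisector of \<open>E\<close> and \<open>F\<close>. Among the corner lying behind \<open>E\<close> as seen
  from \<open>F\<close> and its \<open>d\<close> neighbouring corners, at most one lies closer to \<open>F\<close> than to \<open>E\<close>,
  and the other \<open>d\<close> already
  resolve the grid. They resolve the side of \<open>E\<close>, the mirror construction resolves the side of
  \<open>F\<close>, and \<open>E\<close>, \<open>F\<close> themselves tell the two sides apart. The lower bound counts distance vectors,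
  whose entries are bounded by the diameter.
\<close>

section \<open>Graph distances and resolving sets\<close>

text \<open>Since \<open>f\<close> drops by at most 1 along each edge and vanishes at
  \<open>y\<close>, every walk from \<open>x\<close> to \<open>y\<close> has at least
  \<open>f x\<close> steps, and \<open>walk\<close> attains this. Guessing a distance formula
  \<open>f\<close> thus replaces any analysis of shortest paths.\<close>

lemma graph_dist_eqI:
  assumes walk: "(x, y) \<in> adj_rel Es ^^ f x"
    and lip: "\<And>u v. {u, v} \<in> Es \<Longrightarrow> f u \<le> f v + 1"
    and zero: "f y = 0"
  shows "graph_dist Es x y = f x"
proof -
  have lower: "f x \<le> k" if "(x, y) \<in> adj_rel Es ^^ k" for k x
    using that
  proof (induction k arbitrary: x)
    case 0
    then show ?case using zero by simp
  next
    case (Suc k)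
    then obtain z where "(x, z) \<in> adj_rel Es" "(z, y) \<in> adj_rel Es ^^ k"
      by (meson relpow_Suc_D2)
    then show ?case
      using Suc.IH lip[of x z] by (fastforce simp: adj_rel_def)
  qed
  show ?thesis
    unfolding graph_dist_def using walk lower by (rule Least_equality)
qed

lemma metric_dimension_le:
  "finite R \<Longrightarrow> resolving_set V Es R \<Longrightarrow> metric_dimension V Es \<le> card R"
  unfolding metric_dimension_def by (rule Least_le) blast

lemma card_le_diameter_power_metric_dimension:
  assumes "finite R" "resolving_set V Es R"
    and diam: "\<And>a x. a \<in> V \<Longrightarrow> x \<in> V \<Longrightarrow> graph_dist Es a x \<le> D"
  shows "card V \<le> (D + 1) ^ metric_dimension V Es"
proof -
  \<comment> \<open>The given \<open>R\<close> ensures that the least cardinality is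
    attained.\<close>
  have "\<exists>R. finite R \<and> resolving_set V Es R \<and> card R = metric_dimension V Es"
    unfolding metric_dimension_def
    by (rule LeastI_ex) (use assms(1,2) in blast)
  then obtain S where S: "finite S" "resolving_set V Es S" "card S = metric_dimension V Es"
    by blast
  define \<Phi> where "\<Phi> a = (\<lambda>x\<in>S. graph_dist Es a x)" for a
  have "inj_on \<Phi> V"
  proof (rule inj_onI, rule ccontr)
    fix a b assume ab: "a \<in> V" "b \<in> V" "\<Phi> a = \<Phi> b" "a \<noteq> b"
    then obtain x where x: "x \<in> S" "graph_dist Es a x \<noteq> graph_dist Es b x"
      using S(2) unfolding resolving_set_def by blast
    show False using fun_cong[OF ab(3), of x] x by (simp add: \<Phi>_def)
  qed
  moreover have "\<Phi> ` V \<subseteq> (\<Pi>\<^sub>E x\<in>S. {..D})"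
    using S(2) diam by (auto simp: \<Phi>_def resolving_set_def)
  moreover have "finite (\<Pi>\<^sub>E x\<in>S. {..D})"
    using S(1) by (intro finite_PiE) auto
  ultimately have "card V \<le> card (\<Pi>\<^sub>E x\<in>S. {..D})"
    by (rule card_inj_on_le)
  also have "\<dots> = (D + 1) ^ card S"
    using S(1) by (simp add: card_PiE)
  finally show ?thesis using S(3) by simp
qed

section \<open>The \<open>\<ell>\<^sub>1\<close>-distance on the grid\<close>

definition l1 :: "nat \<Rightarrow> (nat \<Rightarrow> int) \<Rightarrow> (nat \<Rightarrow> int) \<Rightarrow> nat" where
  "l1 d x y = (\<Sum>i=1..d. nat \<bar>x i - y i\<bar>)"

lemma int_l1: "int (l1 d x y) = (\<Sum>i=1..d. \<bar>x i - y i\<bar>)"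
  by (simp add: l1_def)

lemma l1_self [simp]: "l1 d x x = 0"
  by (simp add: l1_def)

lemma l1_commute: "l1 d x y = l1 d y x"
  by (simp add: l1_def abs_minus_commute)

lemma l1_triangle: "l1 d x z \<le> l1 d x y + l1 d y z"
  unfolding l1_def sum.distrib[symmetric] by (intro sum_mono) linarith

lemma l1_split:
  "j \<in> {1..d} \<Longrightarrow> int (l1 d x y) = \<bar>x j - y j\<bar> + (\<Sum>i\<in>{1..d} - {j}. \<bar>x i - y i\<bar>)"
  unfolding int_l1 by (simp add: sum.remove)

lemma l1_adjacent:
  assumes "{u, v} \<in> grid_edges d n"
  shows "l1 d u v = 1"
proof -
  obtain x y i where xy: "{u, v} = {x, y}" "i \<in> {1..d}" "\<bar>x i - y i\<bar> = 1"
    "\<forall>j\<in>{1..d} - {i}. x j = y j"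
    using assms unfolding grid_edges_def by blast
  have "int (l1 d x y) = 1"
    using xy(3,4) by (simp add: l1_split[OF xy(2)])
  then show ?thesis
    using xy(1) l1_commute[of d x y] by (auto simp: doubleton_eq_iff)
qed

lemma grid_verts_eqI:
  assumes "x \<in> grid_verts d n" "y \<in> grid_verts d n" "\<And>i. i \<in> {1..d} \<Longrightarrow> x i = y i"
  shows "x = y"
  using assms unfolding grid_verts_def by (rule PiE_ext)

lemma grid_verts_range:
  "x \<in> grid_verts d n \<Longrightarrow> i \<in> {1..d} \<Longrightarrow> 1 \<le> x i \<and> x i \<le> int (n i)"
  by (auto simp: grid_verts_def PiE_iff)

text \<open>Induction on the distance: changing a coordinate that still differs by one unit towards
  \<open>y\<close> lowers the distance by exactly 1 and stays inside the box.\<close>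

lemma grid_walk:
  assumes "x \<in> grid_verts d n" "y \<in> grid_verts d n"
  shows "(x, y) \<in> adj_rel (grid_edges d n) ^^ l1 d x y"
  using assms
proof (induction "l1 d x y" arbitrary: x)
  case 0
  have "x i = y i" if "i \<in> {1..d}" for i
    using "0.hyps" that by (simp add: l1_def)
  then have "x = y"
    by (rule grid_verts_eqI[OF "0.prems"])
  then show ?case by simp
next
  case (Suc k)
  have "\<exists>i\<in>{1..d}. x i \<noteq> y i"
  proof (rule ccontr)
    assume "\<not> (\<exists>i\<in>{1..d}. x i \<noteq> y i)"
    then have "l1 d x y = 0" by (simp add: l1_def)
    then show False using Suc.hyps(2) by simp
  qed
  then obtain i where i: "i \<in> {1..d}" "x i \<noteq> y i" by blast
  define z where "z = x(i := x i + sgn (y i - x i))"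
  have "x i + sgn (y i - x i) \<in> {1..int (n i)}"
    using grid_verts_range[OF Suc.prems(1) i(1)] grid_verts_range[OF Suc.prems(2) i(1)]
    by (simp add: sgn_if)
  then have z: "z \<in> grid_verts d n"
    using Suc.prems(1) PiE_fun_upd[of _ _ i x "{1..d}"] i(1)
    unfolding z_def grid_verts_def by (simp add: insert_absorb)
  have "\<bar>z i - y i\<bar> = \<bar>x i - y i\<bar> - 1"
    using i(2) by (auto simp: z_def sgn_if)
  moreover have "(\<Sum>j\<in>{1..d} - {i}. \<bar>z j - y j\<bar>) = (\<Sum>j\<in>{1..d} - {i}. \<bar>x j - y j\<bar>)"
    by (rule sum.cong) (auto simp: z_def)
  ultimately have "l1 d z y = k"
    using l1_split[OF i(1), of z y] l1_split[OF i(1), of x y] Suc.hyps(2) by linarith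
  then have "(z, y) \<in> adj_rel (grid_edges d n) ^^ k"
    using Suc.hyps(1)[of z] z Suc.prems(2) by simp
  moreover have "\<exists>i\<in>{1..d}. \<bar>x i - z i\<bar> = 1 \<and> (\<forall>j\<in>{1..d} - {i}. x j = z j)"
    using i by (intro bexI[of _ i]) (auto simp: z_def sgn_if)
  then have "{x, z} \<in> grid_edges d n"
    using Suc.prems(1) z unfolding grid_edges_def by blast
  then have "(x, z) \<in> adj_rel (grid_edges d n)" by (simp add: adj_rel_def)
  ultimately show ?case
    unfolding Suc.hyps(2)[symmetric] by (blast intro: relpow_Suc_I2)
qed

section \<open>Distances after inserting an edge\<close>

lemma adj_relpow_mono:
  assumes "Es \<subseteq> Es'"
  shows "adj_rel Es ^^ k \<subseteq> adj_rel Es' ^^ k"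
proof (induction k)
  case (Suc k)
  have "adj_rel Es \<subseteq> adj_rel Es'" using assms by (auto simp: adj_rel_def)
  then show ?case using Suc.IH by (simp add: relcomp_mono)
qed simp

lemma walk_through_edge:
  assumes "(x, u) \<in> adj_rel Es ^^ k" "{u, v} \<in> Es" "(v, y) \<in> adj_rel Es ^^ m"
  shows "(x, y) \<in> adj_rel Es ^^ (k + 1 + m)"
proof -
  have "(u, v) \<in> adj_rel Es ^^ 1"
    using assms(2) by (simp add: adj_rel_def)
  then show ?thesis
    using assms(1,3) unfolding relpow_add by blast
qed

text \<open>A shortest path uses the new edge at most once, in one of its two directions. Formally,
  the right-hand side, as a function \<open>f\<close> of the first vertex, serves as the potential
  in \<open>graph_dist_eqI\<close>.\<close>

lemma graph_dist_grid_insert_edge: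
  fixes d n E F
  defines "Es \<equiv> grid_edges d n \<union> {{E, F}}"
  assumes V: "x \<in> grid_verts d n" "y \<in> grid_verts d n" "E \<in> grid_verts d n" "F \<in> grid_verts d n"
  shows "graph_dist Es x y =
    min (l1 d x y) (min (l1 d x E + 1 + l1 d F y) (l1 d x F + 1 + l1 d E y))"
proof -
  define f where
    "f u = min (l1 d u y) (min (l1 d u E + 1 + l1 d F y) (l1 d u F + 1 + l1 d E y))" for u
  have walk: "(u, v) \<in> adj_rel Es ^^ l1 d u v"
    if "u \<in> grid_verts d n" "v \<in> grid_verts d n" for u v
    using adj_relpow_mono[of "grid_edges d n" Es] grid_walk[OF that] by (auto simp: Es_def)
  have EF: "{E, F} \<in> Es" "{F, E} \<in> Es"
    by (auto simp: Es_def insert_commute)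
  have "graph_dist Es x y = f x"
  proof (rule graph_dist_eqI)
    show "(x, y) \<in> adj_rel Es ^^ f x"
      using walk[OF V(1,2)] walk_through_edge[OF walk[OF V(1,3)] EF(1) walk[OF V(4,2)]]
        walk_through_edge[OF walk[OF V(1,4)] EF(2) walk[OF V(3,2)]]
      by (simp add: f_def min_def)
    show "f y = 0" by (simp add: f_def)
    fix u v assume "{u, v} \<in> Es"
    then consider "{u, v} \<in> grid_edges d n" | "u = E" "v = F" | "u = F" "v = E"
      unfolding Es_def by (auto simp: doubleton_eq_iff)
    then show "f u \<le> f v + 1"
    proof cases
      case 1
      then have "l1 d u w \<le> l1 d v w + 1" for w
        using l1_adjacent[of u v] l1_triangle[of d u w v] by simp
      from this[of y] this[of E] this[of F] show ?thesis
        unfolding f_def by linarith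
    qed (simp_all add: f_def)
  qed
  then show ?thesis by (simp add: f_def)
qed

text \<open>Either detour costs at least \<open>l1 d x E + l1 d E y\<close>, because its extra step
  pays for replacing a distance to \<open>F\<close> by one to \<open>E\<close>; the triangle
  inequality through \<open>E\<close> finishes. The slack of 1 for \<open>x\<close> makes the two
  sides overlap.\<close>

lemma graph_dist_same_side:
  assumes "x \<in> grid_verts d n" "y \<in> grid_verts d n" "E \<in> grid_verts d n" "F \<in> grid_verts d n"
    and "l1 d x E \<le> l1 d x F + 1" "l1 d y E \<le> l1 d y F"
  shows "graph_dist (grid_edges d n \<union> {{E, F}}) x y = l1 d x y"
  using graph_dist_grid_insert_edge[OF assms(1-4)] assms(5,6) l1_triangle[of d x y E]
    l1_commute[of d y E] l1_commute[of d y F] by simp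

section \<open>Resolving one side by corners\<close>

text \<open>The corner \<open>c\<close> is nearer to \<open>E\<close> by \<open>w i\<close> in every
  coordinate, and \<open>c' j\<close> reverses the sign of \<open>w j\<close> only. So
  \<open>c' j\<close> stays on the side of \<open>E\<close> whenever \<open>w j\<close> is at most
  the sum of the other weights; leaving out a coordinate \<open>m\<close> of maximal weight
  guarantees this.\<close>

lemma one_sided_resolving_corners:
  assumes E: "E \<in> grid_verts d n" and F: "F \<in> grid_verts d n" and d: "d \<ge> 1"
  obtains S where "finite S" "card S \<le> d" "S \<subseteq> grid_verts d n"
    "\<And>x. x \<in> S \<Longrightarrow> l1 d x E \<le> l1 d x F"
    "\<And>a b. a \<in> grid_verts d n \<Longrightarrow> b \<in> grid_verts d n \<Longrightarrow>
       (\<And>x. x \<in> S \<Longrightarrow> l1 d a x = l1 d b x) \<Longrightarrow> a = b"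
proof -
  define w where "w i = \<bar>E i - F i\<bar>" for i
  define near where "near i = (if E i \<le> F i then 1 else int (n i))" for i
  define far where "far i = (if E i \<le> F i then int (n i) else 1)" for i
  define c where "c = (\<lambda>i\<in>{1..d}. near i)"
  define c' where "c' j = c(j := far j)" for j
  have "Max (w ` {1..d}) \<in> w ` {1..d}"
    using d by (intro Max_in) auto
  then obtain m where m: "m \<in> {1..d}" "w m = Max (w ` {1..d})" by auto
  have w_max: "w j \<le> w m" if "j \<in> {1..d}" for j
    unfolding m(2) using that by (intro Max_ge) auto
  have w_nonneg: "0 \<le> w i" for i by (simp add: w_def)
  have corner_range: "1 \<le> near i \<and> near i \<le> int (n i) \<and> 1 \<le> far i \<and> far i \<le> int (n i)"
    if "i \<in> {1..d}" for i
    using grid_verts_range[OF E that] by (auto simp: near_def far_def)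
  have near_excess: "\<bar>near i - F i\<bar> = \<bar>near i - E i\<bar> + w i" if "i \<in> {1..d}" for i
    using grid_verts_range[OF E that] grid_verts_range[OF F that] by (auto simp: near_def w_def)
  have far_excess: "\<bar>far i - E i\<bar> = \<bar>far i - F i\<bar> + w i" if "i \<in> {1..d}" for i
    using grid_verts_range[OF E that] grid_verts_range[OF F that] by (auto simp: far_def w_def)
  let ?J = "{1..d} - {m}"
  define S where "S = insert c (c' ` ?J)"
  have off_sum: "(\<Sum>i\<in>{1..d} - {j}. \<bar>c' j i - a i\<bar>) = (\<Sum>i\<in>{1..d} - {j}. \<bar>c i - a i\<bar>)" for j a
    by (rule sum.cong) (auto simp: c'_def)
  have off_excess: "(\<Sum>i\<in>{1..d} - {j}. \<bar>c i - F i\<bar>) =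
      (\<Sum>i\<in>{1..d} - {j}. \<bar>c i - E i\<bar>) + (\<Sum>i\<in>{1..d} - {j}. w i)" for j
    unfolding sum.distrib[symmetric] by (rule sum.cong) (auto simp: c_def near_excess)
  show thesis
  proof
    show "finite S" by (simp add: S_def)
    have "card S \<le> Suc (card (c' ` ?J))"
      unfolding S_def by (simp add: card_insert_if)
    also have "\<dots> \<le> Suc (card ?J)" by (simp add: card_image_le)
    also have "\<dots> = d" using m(1) by auto
    finally show "card S \<le> d" .
    show "S \<subseteq> grid_verts d n"
      using corner_range
      by (auto simp: S_def c'_def c_def grid_verts_def PiE_iff extensional_def)
  next
    fix x assume "x \<in> S"
    then consider "x = c" | j where "j \<in> ?J" "x = c' j" unfolding S_def by blast
    then show "l1 d x E \<le> l1 d x F"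
    proof cases
      case 1
      have "int (l1 d c E) \<le> int (l1 d c F)"
        unfolding int_l1 by (rule sum_mono) (simp add: c_def near_excess w_nonneg)
      then show ?thesis using 1 by simp
    next
      case (2 j)
      then have j: "j \<in> {1..d}" by simp
      \<comment> \<open>As \<open>j\<close> differs from \<open>m\<close>, the maximal weight is
        among the remaining ones.\<close>
      have "w m \<le> (\<Sum>i\<in>{1..d} - {j}. w i)"
        using 2(1) m(1) by (intro member_le_sum) (auto simp: w_nonneg)
      then have "w j \<le> (\<Sum>i\<in>{1..d} - {j}. w i)"
        using w_max[OF j] by linarith
      moreover have "c' j j = far j" by (simp add: c'_def)
      ultimately have "int (l1 d x E) \<le> int (l1 d x F)"
        using far_excess[OF j] unfolding 2(2) l1_split[OF j] off_sum off_excess by simp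
      then show ?thesis by simp
    qed
  next
    fix a b assume ab: "a \<in> grid_verts d n" "b \<in> grid_verts d n"
      and eq: "\<And>x. x \<in> S \<Longrightarrow> l1 d a x = l1 d b x"
    have eq': "int (l1 d x a) = int (l1 d x b)" if "x \<in> S" for x
      using eq[OF that] by (simp add: l1_commute)
    have agree: "a j = b j" if j: "j \<in> ?J" for j
    proof -
      have j': "j \<in> {1..d}" using j by simp
      have val: "c j = near j" "c' j j = far j" using j' by (auto simp: c_def c'_def)
      \<comment> \<open>Subtracting the distances to \<open>c' j\<close> and \<open>c\<close>
        cancels all other coordinates. What is left is \<open>n j + 1 - 2 * a j\<close> up to a sign
        independent of \<open>a\<close>, so it determines \<open>a j\<close>.\<close>
      have "\<bar>far j - a j\<bar> - \<bar>near j - a j\<bar> = \<bar>far j - b j\<bar> - \<bar>near j - b j\<bar>"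
        using eq'[of c] eq'[of "c' j"] j
        unfolding S_def l1_split[OF j'] off_sum val by simp
      then show ?thesis
        using grid_verts_range[OF ab(1) j'] grid_verts_range[OF ab(2) j'] by (auto simp: near_def far_def split: if_splits)
    qed
    \<comment> \<open>With all other coordinates known, the distance to \<open>c\<close> alone
      yields coordinate \<open>m\<close>, as \<open>near m\<close> is an end of its range.\<close>
    have "(\<Sum>i\<in>?J. \<bar>c i - a i\<bar>) = (\<Sum>i\<in>?J. \<bar>c i - b i\<bar>)"
      by (rule sum.cong) (auto simp: agree)
    then have "\<bar>near m - a m\<bar> = \<bar>near m - b m\<bar>"
      using eq'[of c] m(1) unfolding S_def l1_split[OF m(1)] by (simp add: c_def)
    then have "a m = b m"
      using grid_verts_range[OF ab(1) m(1)] grid_verts_range[OF ab(2) m(1)] by (auto simp: near_def split: if_splits)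
    then have "a i = b i" if "i \<in> {1..d}" for i
      using agree that by (cases "i = m") auto
    then show "a = b" by (rule grid_verts_eqI[OF ab])
  qed
qed

text \<open>Two vertices on a common side are resolved by the corners of that side, where distances
  are those of the grid. Otherwise they lie strictly on opposite sides, and \<open>E\<close> and
  \<open>F\<close> separate them.\<close>

lemma grid_insert_edge_resolving_set:
  fixes d n E F
  defines "Es \<equiv> grid_edges d n \<union> {{E, F}}"
  assumes E: "E \<in> grid_verts d n" and F: "F \<in> grid_verts d n" and d: "d \<ge> 1"
  obtains R where "finite R" "card R \<le> 2 * d + 2" "resolving_set (grid_verts d n) Es R"
proof -
  let ?V = "grid_verts d n"
  obtain S where S: "finite S" "card S \<le> d" "S \<subseteq> ?V"
    "\<And>x. x \<in> S \<Longrightarrow> l1 d x E \<le> l1 d x F"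
    "\<And>a b. a \<in> ?V \<Longrightarrow> b \<in> ?V \<Longrightarrow> (\<And>x. x \<in> S \<Longrightarrow> l1 d a x = l1 d b x) \<Longrightarrow> a = b"
    using one_sided_resolving_corners[OF E F d] by blast
  obtain T where T: "finite T" "card T \<le> d" "T \<subseteq> ?V"
    "\<And>x. x \<in> T \<Longrightarrow> l1 d x F \<le> l1 d x E"
    "\<And>a b. a \<in> ?V \<Longrightarrow> b \<in> ?V \<Longrightarrow> (\<And>x. x \<in> T \<Longrightarrow> l1 d a x = l1 d b x) \<Longrightarrow> a = b"
    using one_sided_resolving_corners[OF F E d] by blast
  define R where "R = insert E (insert F (S \<union> T))"
  have Es': "Es = grid_edges d n \<union> {{F, E}}" by (simp add: Es_def insert_commute)
  have dist_S: "graph_dist Es a x = l1 d a x"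
    if "a \<in> ?V" "x \<in> S" "l1 d a E \<le> l1 d a F + 1" for a x
    unfolding Es_def using that S(3,4) E F by (intro graph_dist_same_side) auto
  have dist_T: "graph_dist Es a x = l1 d a x"
    if "a \<in> ?V" "x \<in> T" "l1 d a F \<le> l1 d a E + 1" for a x
    unfolding Es' using that T(3,4) E F by (intro graph_dist_same_side) auto
  \<comment> \<open>From a vertex at least 2 farther from \<open>E\<close> than from
    \<open>F\<close>, the new edge is a shortcut to \<open>E\<close>. Its distance to
    \<open>E\<close> then exceeds that to \<open>F\<close> by 1; \<open>far_F\<close> gives the
    opposite sign, which settles cases 3 and 4 below.\<close>
  have far_E: "graph_dist Es a E = l1 d a F + 1" "graph_dist Es a F = l1 d a F"
    if "a \<in> ?V" "\<not> l1 d a E \<le> l1 d a F + 1" for a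
    using graph_dist_grid_insert_edge[OF that(1) E E F] graph_dist_grid_insert_edge[OF that(1) F E F]
      that(2) by (simp_all add: Es_def)
  have far_F: "graph_dist Es a E = l1 d a E" "graph_dist Es a F = l1 d a E + 1"
    if "a \<in> ?V" "\<not> l1 d a F \<le> l1 d a E + 1" for a
    using graph_dist_grid_insert_edge[OF that(1) E E F] graph_dist_grid_insert_edge[OF that(1) F E F]
      that(2) by (simp_all add: Es_def)
  have "a = b"
    if ab: "a \<in> ?V" "b \<in> ?V" and eq: "\<And>x. x \<in> R \<Longrightarrow> graph_dist Es a x = graph_dist Es b x" for a b
  proof -
    consider "l1 d a E \<le> l1 d a F + 1" "l1 d b E \<le> l1 d b F + 1"
      | "l1 d a F \<le> l1 d a E + 1" "l1 d b F \<le> l1 d b E + 1"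
      | "\<not> l1 d a E \<le> l1 d a F + 1" "\<not> l1 d b F \<le> l1 d b E + 1"
      | "\<not> l1 d a F \<le> l1 d a E + 1" "\<not> l1 d b E \<le> l1 d b F + 1"
      by linarith
    then show "a = b"
    proof cases
      case 1
      have "l1 d a x = l1 d b x" if "x \<in> S" for x
        using dist_S[OF ab(1) that 1(1)] dist_S[OF ab(2) that 1(2)] eq[of x] that
        by (simp add: R_def)
      then show ?thesis by (rule S(5)[OF ab])
    next
      case 2
      have "l1 d a x = l1 d b x" if "x \<in> T" for x
        using dist_T[OF ab(1) that 2(1)] dist_T[OF ab(2) that 2(2)] eq[of x] that
        by (simp add: R_def)
      then show ?thesis by (rule T(5)[OF ab])
    next
      case 3
      then show ?thesis
        using eq[of E] eq[of F] far_E[OF ab(1)] far_F[OF ab(2)] by (simp add: R_def)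
    next
      case 4
      then show ?thesis
        using eq[of E] eq[of F] far_F[OF ab(1)] far_E[OF ab(2)] by (simp add: R_def)
    qed
  qed
  then have "resolving_set ?V Es R"
    using E F S(3) T(3) unfolding resolving_set_def R_def by blast
  moreover have "card R \<le> card (S \<union> T) + 2"
    unfolding R_def using S(1) T(1) by (simp add: card_insert_if)
  then have "card R \<le> 2 * d + 2"
    using card_Un_le[of S T] S(2) T(2) by linarith
  moreover have "finite R" using S(1) T(1) by (simp add: R_def)
  ultimately show thesis using that by blast
qed

section \<open>Size and diameter of the grid\<close>

lemma card_grid_verts: "card (grid_verts d n) = (\<Prod>i=1..d. n i)"
  by (simp add: grid_verts_def card_PiE)

lemma l1_le_diameter:
  assumes "x \<in> grid_verts d n" "y \<in> grid_verts d n"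
  shows "int (l1 d x y) \<le> (\<Sum>i=1..d. int (n i)) - int d"
proof -
  have "int (l1 d x y) \<le> (\<Sum>i=1..d. int (n i) - 1)"
    unfolding int_l1
  proof (rule sum_mono)
    fix i assume "i \<in> {1..d}"
    then show "\<bar>x i - y i\<bar> \<le> int (n i) - 1"
      using grid_verts_range[OF assms(1)] grid_verts_range[OF assms(2)] by fastforce
  qed
  then show ?thesis by (simp add: sum_subtractf)
qed

theorem theorem1:
  fixes d :: nat and n :: "nat \<Rightarrow> nat" and E F :: "nat \<Rightarrow> int"
  assumes "E \<in> grid_verts d n" and "F \<in> grid_verts d n"
    and "E \<noteq> F" and "{E, F} \<notin> grid_edges d n"
  shows "metric_dimension (grid_verts d n) (grid_edges d n \<union> {{E, F}}) \<le> 2 * d + 2 \<and>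
    real (metric_dimension (grid_verts d n) (grid_edges d n \<union> {{E, F}}))
      \<ge> ln (\<Prod>i=1..d. real (n i)) / ln ((\<Sum>i=1..d. real (n i)) - real d + 1)"
proof
  let ?V = "grid_verts d n" and ?Es = "grid_edges d n \<union> {{E, F}}"
  define \<beta> where "\<beta> = metric_dimension ?V ?Es"
  obtain i where i: "i \<in> {1..d}" "E i \<noteq> F i"
    using assms(3) grid_verts_eqI[OF assms(1,2)] by blast
  then have d: "d \<ge> 1" by auto
  obtain R where R: "finite R" "card R \<le> 2 * d + 2" "resolving_set ?V ?Es R"
    using grid_insert_edge_resolving_set[OF assms(1,2) d] by blast
  show "metric_dimension ?V ?Es \<le> 2 * d + 2"
    using metric_dimension_le[OF R(1,3)] R(2) by linarith
  \<comment> \<open>\<open>D\<close> is the diameter bound of the grid. The truncation by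
    \<open>nat\<close> is harmless once \<open>D > 0\<close> is known.\<close>
  define D where "D = nat ((\<Sum>i=1..d. int (n i)) - int d)"
  have l1_le: "l1 d x y \<le> D" if "x \<in> ?V" "y \<in> ?V" for x y
    using l1_le_diameter[OF that] by (simp add: D_def)
  \<comment> \<open>Distinctness of \<open>E\<close> and \<open>F\<close> makes \<open>D\<close>
    positive, hence \<open>ln (real (D + 1))\<close> is positive and may be divided by.\<close>
  have "l1 d E F \<noteq> 0"
    using i by (auto simp: l1_def)
  then have D_pos: "D > 0"
    using l1_le[OF assms(1,2)] by simp
  then have "int D = (\<Sum>i=1..d. int (n i)) - int d"
    by (simp add: D_def)
  then have "real_of_int (int D) = real_of_int ((\<Sum>i=1..d. int (n i)) - int d)"
    by simp
  then have D_real: "real (D + 1) = (\<Sum>i=1..d. real (n i)) - real d + 1"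
    by simp
  \<comment> \<open>Adding an edge only shortens distances, so \<open>D\<close> still bounds
    them.\<close>
  have "graph_dist ?Es a x \<le> D" if "a \<in> ?V" "x \<in> ?V" for a x
    using graph_dist_grid_insert_edge[OF that assms(1,2)] l1_le[OF that] by simp
  then have "card ?V \<le> (D + 1) ^ \<beta>"
    unfolding \<beta>_def by (rule card_le_diameter_power_metric_dimension[OF R(1,3)])
  then have "real (\<Prod>i=1..d. n i) \<le> real ((D + 1) ^ \<beta>)"
    unfolding card_grid_verts of_nat_le_iff .
  then have le: "(\<Prod>i=1..d. real (n i)) \<le> real (D + 1) ^ \<beta>"
    by simp
  have "n i > 0" if "i \<in> {1..d}" for i
    using grid_verts_range[OF assms(1) that] by linarith
  then have "(\<Prod>i=1..d. real (n i)) > 0"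
    by (intro prod_pos) simp
  then have "ln (\<Prod>i=1..d. real (n i)) \<le> ln (real (D + 1) ^ \<beta>)"
    using le by simp
  also have "\<dots> = real \<beta> * ln (real (D + 1))"
    by (rule ln_realpow)
  finally have "ln (\<Prod>i=1..d. real (n i)) / ln (real (D + 1)) \<le> real \<beta>"
    using D_pos by (simp add: divide_le_eq)
  then show "real (metric_dimension ?V ?Es)
      \<ge> ln (\<Prod>i=1..d. real (n i)) / ln ((\<Sum>i=1..d. real (n i)) - real d + 1)"
    unfolding D_real \<beta>_def .
qed

end
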